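(* The MGreedy algorithm achieves an approximation factor of $1-1/\sqrt{\mathrm e}$: for every instance, its output $S_{\mathrm m}$ satisfies $f(S_{\mathrm m})\ge(1-1/\sqrt{\mathrm e})\, f(\mathrm{OPT})$.
   Context: Problem: $V$ is a finite ground set; $f:2^V\to\mathbb{R}$ is monotone nondecreasing, submodular, and $f(\emptyset)=0$. Each element $v$ has a cost $c(v)>0$, $c(S)=\sum_{v\in S}c(v)$, and the budget $b$ satisfies $c(v)\le b$ for all $v$. The problem is $\max f(S)$ subject to $c(S)\le b$, with optimal solution $\mathrm{OPT}$. Write $f(v\mid S)=f(S\cup\{v\})-f(S)$. MGreedy: set $S_{\mathrm g}\gets\emptyset$, $V'\gets V$. While $V'\neq\emptyset$: pick $u\in V'$ maximizing $f(u\mid S_{\mathrm g})/c(u)$ (ties arbitrary); if $c(S_{\mathrm g})+c(u)\le b$ add $u$ to $S_{\mathrm g}$; remove $u$ from $V'$. Then let $v^*\in\arg\max_v f(\{v\})$ and output $S_{\mathrm m}$, whichever of $\{v^*\},S_{\mathrm g}$ has the larger $f$-value. *)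

theory Defs
  imports Complex_Main
begin

definition submodular_on :: "'a set \<Rightarrow> ('a set \<Rightarrow> real) \<Rightarrow> bool" where
  "submodular_on V f \<longleftrightarrow>
     (\<forall>A B. A \<subseteq> V \<longrightarrow> B \<subseteq> V \<longrightarrow> f (A \<union> B) + f (A \<inter> B) \<le> f A + f B)"

definition marginal :: "('a set \<Rightarrow> real) \<Rightarrow> 'a \<Rightarrow> 'a set \<Rightarrow> real" where
  "marginal f v S = f (S \<union> {v}) - f S"

definition feasible :: "'a set \<Rightarrow> ('a \<Rightarrow> real) \<Rightarrow> real \<Rightarrow> 'a set \<Rightarrow> bool" where
  "feasible V c b S \<longleftrightarrow> S \<subseteq> V \<and> sum c S \<le> b"

text \<open>
  \<open>greedy_run f c b S V' T\<close>: the greedy loop, entered with current solution \<open>S\<close> and remaining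
  candidates \<open>V'\<close>, can terminate with solution \<open>T\<close>. This is a relation rather than a function
  because ties in the choice of \<open>u\<close> are broken arbitrarily.
\<close>

inductive greedy_run ::
    "('a set \<Rightarrow> real) \<Rightarrow> ('a \<Rightarrow> real) \<Rightarrow> real \<Rightarrow> 'a set \<Rightarrow> 'a set \<Rightarrow> 'a set \<Rightarrow> bool"
  for f :: "'a set \<Rightarrow> real" and c :: "'a \<Rightarrow> real" and b :: real
where
  finish: "greedy_run f c b S {} S"
| take: "is_arg_max (\<lambda>v. marginal f v S / c v) (\<lambda>v. v \<in> V') u \<Longrightarrow> sum c S + c u \<le> b \<Longrightarrow>
    greedy_run f c b (S \<union> {u}) (V' - {u}) T \<Longrightarrow> greedy_run f c b S V' T"
| skip: "is_arg_max (\<lambda>v. marginal f v S / c v) (\<lambda>v. v \<in> V') u \<Longrightarrow> \<not> sum c S + c u \<le> b \<Longrightarrow>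
    greedy_run f c b S (V' - {u}) T \<Longrightarrow> greedy_run f c b S V' T"

text \<open>
  \<open>mgreedy V f c b Sm\<close>: \<open>Sm\<close> is a possible output. For empty \<open>V\<close> there is no best singleton,
  and the greedy solution is returned.
\<close>

definition mgreedy ::
    "'a set \<Rightarrow> ('a set \<Rightarrow> real) \<Rightarrow> ('a \<Rightarrow> real) \<Rightarrow> real \<Rightarrow> 'a set \<Rightarrow> bool" where
  "mgreedy V f c b Sm \<longleftrightarrow>
     (\<exists>Sg. greedy_run f c b {} V Sg \<and>
        (if V = {} then Sm = Sg
         else \<exists>vstar. is_arg_max (\<lambda>v. f {v}) (\<lambda>v. v \<in> V) vstar \<and>
                is_arg_max f (\<lambda>S. S \<in> {{vstar}, Sg}) Sm))"

text \<open>Some output always exists, and every output is a feasible solution.\<close>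

lemma ex_is_arg_max_finite:
  fixes g :: "'b \<Rightarrow> real"
  assumes "finite A" "A \<noteq> {}"
  shows "\<exists>x. is_arg_max g (\<lambda>x. x \<in> A) x"
proof -
  have "Max (g ` A) \<in> g ` A" using assms by simp
  then obtain x where x: "x \<in> A" "g x = Max (g ` A)" by auto
  then have "\<not> g y > g x" if "y \<in> A" for y using assms(1) that by (simp add: not_less)
  then show ?thesis using x(1) unfolding is_arg_max_def by blast
qed

lemma greedy_run_exists:
  assumes "finite V'"
  shows "\<exists>T. greedy_run f c b S V' T"
  using assms
proof (induction "card V'" arbitrary: V' S)
  case 0
  then have "V' = {}" by simp
  then show ?case using greedy_run.finish[of f c b S] by blast
next
  case (Suc n)
  then have "V' \<noteq> {}" by auto
  then obtain u where u: "is_arg_max (\<lambda>v. marginal f v S / c v) (\<lambda>v. v \<in> V') u"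
    using ex_is_arg_max_finite[OF Suc.prems] by blast
  then have "u \<in> V'" by (simp add: is_arg_max_def)
  then have "n = card (V' - {u})" "finite (V' - {u})" using Suc.hyps(2) Suc.prems by simp_all
  then have "\<exists>T. greedy_run f c b R (V' - {u}) T" for R using Suc.hyps(1) by blast
  then obtain R1 R2 where "greedy_run f c b (S \<union> {u}) (V' - {u}) R1"
    and "greedy_run f c b S (V' - {u}) R2" by blast
  then show ?case
    using greedy_run.take[OF u, of b R1] greedy_run.skip[OF u, of b R2]
    by (cases "sum c S + c u \<le> b") auto
qed

lemma mgreedy_exists:
  assumes "finite V"
  shows "\<exists>Sm. mgreedy V f c b Sm"
proof -
  obtain Sg where g: "greedy_run f c b {} V Sg" using greedy_run_exists[OF assms] by blast
  show ?thesis
  proof (cases "V = {}")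
    case True
    then show ?thesis using g unfolding mgreedy_def by auto
  next
    case False
    then obtain v where v: "is_arg_max (\<lambda>v. f {v}) (\<lambda>v. v \<in> V) v"
      using ex_is_arg_max_finite[OF assms] by blast
    obtain Sm where "is_arg_max f (\<lambda>S. S \<in> {{v}, Sg}) Sm"
      using ex_is_arg_max_finite[of "{{v}, Sg}" f] by auto
    then show ?thesis using False g v unfolding mgreedy_def by auto
  qed
qed

lemma greedy_run_feasible:
  assumes "greedy_run f c b S V' T" "finite V" "V' \<subseteq> V" "S \<inter> V' = {}" "feasible V c b S"
  shows "feasible V c b T"
  using assms
proof (induction rule: greedy_run.induct)
  case (take S V' u T)
  have u: "u \<in> V'" using take.hyps(1) by (simp add: is_arg_max_def)
  have "finite S" using take.prems(1,4) finite_subset unfolding feasible_def by blast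
  moreover have "u \<notin> S" using u take.prems(3) by blast
  ultimately have "feasible V c b (S \<union> {u})"
    using take.hyps(2) take.prems(2,4) u unfolding feasible_def by (auto simp: add.commute)
  moreover have "V' - {u} \<subseteq> V" "(S \<union> {u}) \<inter> (V' - {u}) = {}" using take.prems(2,3) by auto
  ultimately show ?case using take.IH take.prems(1) by simp
next
  case (skip S V' u T)
  have "V' - {u} \<subseteq> V" "S \<inter> (V' - {u}) = {}" using skip.prems(2,3) by auto
  then show ?case using skip.IH skip.prems(1,4) by simp
qed simp

lemma mgreedy_feasible:
  assumes "finite V" "\<And>v. v \<in> V \<Longrightarrow> c v \<le> b" "0 \<le> b" "mgreedy V f c b Sm"
  shows "feasible V c b Sm"
proof -
  obtain Sg where g: "greedy_run f c b {} V Sg"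
    and m: "if V = {} then Sm = Sg
         else \<exists>vstar. is_arg_max (\<lambda>v. f {v}) (\<lambda>v. v \<in> V) vstar \<and>
                is_arg_max f (\<lambda>S. S \<in> {{vstar}, Sg}) Sm"
    using assms(4) unfolding mgreedy_def by blast
  have "feasible V c b Sg"
    using greedy_run_feasible[OF g assms(1)] assms(3) by (simp add: feasible_def)
  then show ?thesis using m assms(2)
    by (auto simp: is_arg_max_def feasible_def split: if_splits)
qed

end

theory Submission
  imports Defs "HOL-Analysis.Complex_Transcendental"
begin

text \<open>
  Each greedy step gains value at a rate of at least \<open>(f O - f S) / c(O)\<close>, for every target
  set \<open>O\<close> none of whose elements has been rejected, so that \<open>f O - f S\<close> decays exponentially in
  \<open>c(S) / c(O)\<close>. With \<open>O = OPT\<close> this suffices as soon as \<open>c(S) \<ge> b / 2\<close> is reached, which can only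
  fail if \<open>OPT\<close> has an element \<open>p\<close> with \<open>c(p) > b / 2\<close>. If \<open>{p}\<close> itself is not good enough, then
  \<open>OPT - {p}\<close> keeps a fraction \<open>\<beta> = exp (-1/2)\<close> of the optimum at a cost below \<open>b / 2\<close>. If
  this cost is at most \<open>29 b / 60\<close>, then \<open>OPT - {p}\<close> alone is a good enough target. Otherwise
  \<open>c(p) < 31 b / 60\<close>, so the cost \<open>29 b / 60\<close> is reached before \<open>p\<close>, or any other element of
  \<open>OPT\<close> (all are cheaper), can be rejected; the target
  \<open>OPT - {p}\<close> up to cost \<open>b / 4\<close> followed by the target \<open>OPT\<close> then gives the bound.
\<close>

section \<open>Submodularity and the greedy rate\<close>

lemma submodular_union_le_sum_marginal:
  assumes "submodular_on V f" "S \<subseteq> V" "finite R" "R \<subseteq> V"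
  shows "f (S \<union> R) \<le> f S + (\<Sum>v\<in>R. marginal f v S)"
  using assms(3,4)
proof (induction R rule: finite_induct)
  case (insert v R)
  show ?case
  proof (cases "v \<in> S")
    case True
    then have "marginal f v S = 0" "S \<union> insert v R = S \<union> R"
      by (auto simp: marginal_def insert_absorb)
    then show ?thesis using insert by simp
  next
    case False
    have "S \<union> R \<subseteq> V" "S \<union> {v} \<subseteq> V" using assms(2) insert.prems by auto
    then have "f ((S \<union> R) \<union> (S \<union> {v})) + f ((S \<union> R) \<inter> (S \<union> {v})) \<le> f (S \<union> R) + f (S \<union> {v})"
      using assms(1) unfolding submodular_on_def by blast
    moreover have "(S \<union> R) \<union> (S \<union> {v}) = S \<union> insert v R" by auto
    moreover have "(S \<union> R) \<inter> (S \<union> {v}) = S" using False insert.hyps by auto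
    ultimately show ?thesis using insert by (simp add: marginal_def)
  qed
qed simp

text \<open>Monotonicity and submodularity charge the gap to the marginals of \<open>R - S\<close>,
  each at most \<open>D\<close> per unit cost; since \<open>0 \<le> D\<close>, elements already in
  \<open>S\<close> can be charged too.\<close>

lemma gap_le_density_times_cost:
  assumes "finite V" "mono_on (Pow V) f" "submodular_on V f" "\<And>v. v \<in> V \<Longrightarrow> 0 < c v"
    and "S \<subseteq> V" "R \<subseteq> V" "0 \<le> D" "\<And>v. v \<in> R - S \<Longrightarrow> marginal f v S / c v \<le> D"
  shows "f R - f S \<le> D * sum c R"
proof -
  have fin: "finite R" using assms(1,6) finite_subset by blast
  have "f R \<le> f (S \<union> (R - S))"
    using assms(5,6) by (intro mono_onD[OF assms(2)]) auto
  also have "\<dots> \<le> f S + (\<Sum>v\<in>R - S. marginal f v S)"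
    using submodular_union_le_sum_marginal[OF assms(3,5), of "R - S"] fin assms(6) by blast
  also have "(\<Sum>v\<in>R - S. marginal f v S) \<le> (\<Sum>v\<in>R - S. D * c v)"
  proof (rule sum_mono)
    fix v assume v: "v \<in> R - S"
    then have "0 < c v" using assms(4,6) by blast
    then show "marginal f v S \<le> D * c v" using assms(8)[OF v] by (simp add: pos_divide_le_eq)
  qed
  also have "\<dots> \<le> (\<Sum>v\<in>R. D * c v)"
    using fin assms(4,6,7) by (intro sum_mono2) (auto intro: mult_nonneg_nonneg less_imp_le)
  finally show ?thesis by (simp add: sum_distrib_left)
qed

lemma greedy_run_superset: "greedy_run f c b S V' T \<Longrightarrow> S \<subseteq> T"
  by (induction rule: greedy_run.induct) auto

lemma greedy_run_subset: "greedy_run f c b S V' T \<Longrightarrow> T \<subseteq> S \<union> V'"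
  by (induction rule: greedy_run.induct) (auto simp: is_arg_max_def)

text \<open>Until an element of \<open>R\<close> is rejected, all of \<open>R - S\<close> are still
  candidates, so the greedy choice matches or beats their densities. Rejections outside
  \<open>R\<close> leave the solution unchanged. \<open>I\<close> stays abstract because two
  different decay invariants are plugged in.\<close>

lemma greedy_run_first_rejection:
  assumes "greedy_run f c b S V' T"
    and "S \<subseteq> V" "V' \<subseteq> V" "S \<inter> V' = {}" "R \<subseteq> S \<union> V'" "I S"
    and step: "\<And>S u. S \<subseteq> V \<Longrightarrow> u \<in> V - S \<Longrightarrow> I S \<Longrightarrow>
      (\<And>v. v \<in> R - S \<Longrightarrow> marginal f v S / c v \<le> marginal f u S / c u) \<Longrightarrow> I (insert u S)"
  obtains "R \<subseteq> T"
  | S' q where "S' \<subseteq> T" "I S'" "q \<in> R" "b < sum c S' + c q"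
proof -
  have "R \<subseteq> T \<or> (\<exists>S' q. S' \<subseteq> T \<and> I S' \<and> q \<in> R \<and> b < sum c S' + c q)"
    using assms(1-6)
  proof (induction rule: greedy_run.induct)
    case (finish S)
    then show ?case by simp
  next
    case (take S V' u T)
    have u: "u \<in> V'" "\<And>v. v \<in> V' \<Longrightarrow> marginal f v S / c v \<le> marginal f u S / c u"
      using take.hyps(1) by (auto simp: is_arg_max_linorder)
    have "I (insert u S)"
      by (rule step) (use take.prems u in blast)+
    moreover have "S \<union> {u} \<subseteq> V" "V' - {u} \<subseteq> V" "(S \<union> {u}) \<inter> (V' - {u}) = {}"
      "R \<subseteq> S \<union> {u} \<union> (V' - {u})"
      using take.prems u(1) by auto
    ultimately show ?case using take.IH by simp
  next
    case (skip S V' u T)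
    show ?case
    proof (cases "u \<in> R")
      case True
      then show ?thesis
        using skip.hyps(2) skip.prems(5) greedy_run_superset[OF skip.hyps(3)]
        by (meson not_less)
    next
      case False
      then show ?thesis using skip.prems by (intro skip.IH) auto
    qed
  qed
  then show thesis using that by blast
qed

section \<open>Exponential decay of the gap\<close>

text \<open>A step of density \<open>D\<close> and cost \<open>\<delta>\<close> multiplies a
  positive gap by at most \<open>1 - \<delta> / \<kappa>\<close>, which is at most
  \<open>exp (- \<delta> / \<kappa>)\<close>.\<close>

lemma gap_decay_step:
  fixes A F D \<kappa> \<delta> K x :: real
  assumes "0 < \<kappa>" "0 \<le> \<delta>" "0 \<le> D" "0 \<le> K"
    and "A - F \<le> D * \<kappa>" "A - F \<le> K * exp (- x / \<kappa>)"
  shows "A - (F + D * \<delta>) \<le> K * exp (- (x + \<delta>) / \<kappa>)"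
proof (cases "A - F \<le> 0")
  case True
  then have "A - (F + D * \<delta>) \<le> 0" using assms(2,3) by (simp add: add_increasing2)
  also have "\<dots> \<le> K * exp (- (x + \<delta>) / \<kappa>)" using assms(4) by simp
  finally show ?thesis .
next
  case False
  have "(A - F) / \<kappa> \<le> D" using assms(1,5) by (simp add: pos_divide_le_eq)
  then have "(A - F) / \<kappa> * \<delta> \<le> D * \<delta>" using assms(2) by (rule mult_right_mono)
  then have "A - (F + D * \<delta>) \<le> (A - F) * (1 + - \<delta> / \<kappa>)" by (simp add: algebra_simps)
  also have "\<dots> \<le> (A - F) * exp (- \<delta> / \<kappa>)"
    using False by (intro mult_left_mono exp_ge_add_one_self) simp
  also have "\<dots> \<le> K * exp (- x / \<kappa>) * exp (- \<delta> / \<kappa>)"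
    using assms(6) by (intro mult_right_mono) simp_all
  also have "\<dots> = K * exp (- (x + \<delta>) / \<kappa>)"
    by (simp add: mult.assoc flip: exp_add) (simp add: diff_divide_distrib)
  finally show ?thesis .
qed

section \<open>Numerical estimates of exponentials\<close>

lemma exp_neg_half_bounds:
  "606/1000 < exp (- 1/2 :: real)" "exp (- 1/2 :: real) < 607/1000"
proof -
  have e: "27182/10000 < exp (1::real)" "exp (1::real) < 27183/10000"
    using e_approx_32 by (simp_all add: abs_if split: if_splits)
  have "exp (- 1/2 :: real) ^ 2 = exp (- 1)" by (simp flip: exp_of_nat_mult)
  then have sq: "exp (- 1/2 :: real) ^ 2 = 1 / exp 1" by (simp add: exp_minus inverse_eq_divide)
  have "(606/1000)\<^sup>2 < (1 / exp 1 :: real)" using e by (simp add: field_simps power2_eq_square)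
  then show "606/1000 < exp (- 1/2 :: real)"
    unfolding sq[symmetric] by (rule power_less_imp_less_base) simp
  have "(1 / exp 1 :: real) < (607/1000)\<^sup>2" using e by (simp add: field_simps power2_eq_square)
  then show "exp (- 1/2 :: real) < 607/1000"
    unfolding sq[symmetric] by (rule power_less_imp_less_base) simp
qed

text \<open>Serves a target of cost at most \<open>29 b / 60\<close>: the cost reached before one of
  its elements is rejected is at least \<open>31/29\<close> times the target's. The 29th power
  reduces the claim to rational arithmetic.\<close>

lemma light_remainder_constant:
  defines "\<beta> \<equiv> exp (- 1/2 :: real)"
  shows "1 - \<beta> \<le> \<beta> * (1 - exp (- 31/29))"
proof -
  have "exp (- 31/29 :: real) ^ 29 = exp (- 31)" by (simp flip: exp_of_nat_mult)
  also have "\<dots> = 1 / exp 1 ^ 31"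
    by (simp add: exp_minus inverse_eq_divide flip: exp_of_nat_mult)
  also have "\<dots> \<le> 1 / (27/10) ^ 31"
    using e_approx_32 by (intro divide_left_mono power_mono) (auto simp: abs_if split: if_splits)
  also have "\<dots> \<le> (349/1000) ^ 29" by (simp add: power_divide)
  finally have "exp (- 31/29 :: real) \<le> 349/1000"
    by (subst (asm) power_mono_iff) simp_all
  then have "\<beta> * exp (- 31/29) \<le> \<beta> * (349/1000)"
    unfolding \<beta>_def by (intro mult_left_mono) simp_all
  then show ?thesis
    using exp_neg_half_bounds(1) unfolding \<beta>_def right_diff_distrib by linarith
qed

text \<open>Here \<open>7/30 = 29/60 - 1/4\<close> is the budget share certainly spent in the second
  phase.\<close>

lemma heavy_remainder_constant:
  defines "\<beta> \<equiv> exp (- 1/2 :: real)"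
  shows "(1 - \<beta> + \<beta>\<^sup>2) * exp (- 7/30) \<le> \<beta>"
proof -
  have "exp (- 7/30 :: real) ^ 30 = exp (- 7)" by (simp flip: exp_of_nat_mult)
  also have "\<dots> = 1 / exp 1 ^ 7"
    by (simp add: exp_minus inverse_eq_divide flip: exp_of_nat_mult)
  also have "\<dots> \<le> 1 / (27/10) ^ 7"
    using e_approx_32 by (intro divide_left_mono power_mono) (auto simp: abs_if split: if_splits)
  also have "\<dots> \<le> (795/1000) ^ 30" by (simp add: power_divide)
  finally have e: "exp (- 7/30 :: real) \<le> 795/1000"
    by (subst (asm) power_mono_iff) simp_all
  \<comment> \<open>Replacing one factor only keeps the bound linear in \<open>\<beta>\<close>. The
    margin is thin: 0.762 * 0.795 = 0.60579, against 0.606.\<close>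
  have "\<beta> * (\<beta> - 1) \<le> \<beta> * (607/1000 - 1)"
    using exp_neg_half_bounds unfolding \<beta>_def by (intro mult_left_mono) simp_all
  then have "\<beta>\<^sup>2 - \<beta> \<le> - (393/1000) * \<beta>" by (simp add: algebra_simps power2_eq_square)
  then have "1 - \<beta> + \<beta>\<^sup>2 \<le> 762/1000"
    using exp_neg_half_bounds(1) unfolding \<beta>_def by linarith
  then have "(1 - \<beta> + \<beta>\<^sup>2) * exp (- 7/30) \<le> 762/1000 * (795/1000)"
    using e by (intro mult_mono) simp_all
  then show ?thesis using exp_neg_half_bounds(1) unfolding \<beta>_def by simp
qed

section \<open>The approximation factor\<close>

text \<open>
  The first target has value at least \<open>\<beta> * w\<close> and cost at most \<open>b / 2\<close>, the second one has
  value \<open>w\<close> and cost at most \<open>b\<close>. The constant of the second bound makes the phases match: at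
  \<open>x = b / 4\<close> the first bound reads \<open>\<beta> * w - F \<le> \<beta>\<^sup>2 * w\<close>, as \<open>exp (-1/2) = \<beta>\<close>.
\<close>

definition two_phase :: "real \<Rightarrow> real \<Rightarrow> real \<Rightarrow> real \<Rightarrow> real \<Rightarrow> bool" where
  "two_phase b w \<beta> x F \<longleftrightarrow>
     (x \<le> b/4 \<longrightarrow> \<beta> * w - F \<le> \<beta> * w * exp (- x / (b/2))) \<and>
     (b/4 \<le> x \<longrightarrow> w - F \<le> (1 - \<beta> + \<beta>\<^sup>2) * w * exp (1/4) * exp (- x / b))"

lemma two_phase_step:
  fixes b w F D \<delta> x :: real
  defines "\<beta> \<equiv> exp (- 1/2 :: real)"
  assumes "0 < b" "0 \<le> w" "0 \<le> \<delta>" "0 \<le> D"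
    and small: "\<beta> * w - F \<le> D * (b/2)" and full: "w - F \<le> D * b"
    and "two_phase b w \<beta> x F"
  shows "two_phase b w \<beta> (x + \<delta>) (F + D * \<delta>)"
proof -
  let ?K = "(1 - \<beta> + \<beta>\<^sup>2) * w * exp (1/4)"
  have \<beta>: "0 < \<beta>" "\<beta> < 1" using exp_neg_half_bounds unfolding \<beta>_def by simp_all
  have K: "0 \<le> ?K" using \<beta> assms(3) by (intro mult_nonneg_nonneg) simp_all
  have first: "\<beta> * w - (F + D * d) \<le> \<beta> * w * exp (- (x + d) / (b/2))"
    if "x \<le> b/4" "0 \<le> d" for d
    using assms(2-) that \<beta> unfolding two_phase_def by (intro gap_decay_step) simp_all
  have "w - (F + D * \<delta>) \<le> ?K * exp (- (x + \<delta>) / b)" if "b/4 \<le> x + \<delta>"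
  proof (cases "b/4 \<le> x")
    case True
    then show ?thesis
      using assms(2-) K unfolding two_phase_def by (intro gap_decay_step) simp_all
  next
    case False
    \<comment> \<open>A step across \<open>b / 4\<close> is split there; the density \<open>D\<close> serves both parts.\<close>
    define d where "d = b/4 - x"
    have d: "0 \<le> d" "d \<le> \<delta>" using False that unfolding d_def by simp_all
    have "\<beta> * w - (F + D * d) \<le> \<beta> * w * exp (- (x + d) / (b/2))"
      using first d False by simp
    also have "exp (- (x + d) / (b/2)) = \<beta>"
      using assms(2) unfolding d_def \<beta>_def by simp
    \<comment> \<open>Raising the target value from \<open>\<beta> * w\<close> to \<open>w\<close>
      adds \<open>(1 - \<beta>) * w\<close> to the gap.\<close>
    finally have "w - (F + D * d) \<le> (1 - \<beta> + \<beta>\<^sup>2) * w"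
      by (simp add: algebra_simps power2_eq_square)
    also have "\<dots> = ?K * exp (- (b/4) / b)"
      using assms(2) by (simp add: mult.assoc flip: exp_add)
    finally have mid: "w - (F + D * d) \<le> ?K * exp (- (b/4) / b)" .
    have "0 \<le> D * d" using assms(5) d by simp
    then have "w - (F + D * d) \<le> D * b" using full by linarith
    from gap_decay_step[OF assms(2) _ assms(5) K this mid, of "\<delta> - d"] d
    show ?thesis by (simp add: d_def algebra_simps)
  qed
  then show ?thesis using first[of \<delta>] assms(4) unfolding two_phase_def by auto
qed

text \<open>\<open>A\<close> may lie below \<open>f R\<close>: for the optimum without its expensive
  element, only a fraction of the optimal value is guaranteed.\<close>

lemma greedy_run_gap_decay:
  fixes V :: "'a set" and f :: "'a set \<Rightarrow> real"
  assumes V: "finite V" and mono: "mono_on (Pow V) f" and sub: "submodular_on V f"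
    and zero: "f {} = 0" and c: "\<And>v. v \<in> V \<Longrightarrow> 0 < c v"
    and run: "greedy_run f c b {} V T" and R: "R \<subseteq> V"
    and A: "0 \<le> A" "A \<le> f R" and \<kappa>: "0 < \<kappa>" "sum c R \<le> \<kappa>"
  obtains "R \<subseteq> T"
  | S q where "S \<subseteq> T" "q \<in> R" "b < sum c S + c q" "A - f S \<le> A * exp (- sum c S / \<kappa>)"
proof -
  let ?I = "\<lambda>S. A - f S \<le> A * exp (- sum c S / \<kappa>)"
  have step: "?I (insert u S)"
    if S: "S \<subseteq> V" "u \<in> V - S" and I: "?I S"
      and u: "\<And>v. v \<in> R - S \<Longrightarrow> marginal f v S / c v \<le> marginal f u S / c u" for S u
  proof -
    let ?D = "marginal f u S / c u"
    have cu: "0 < c u" using c S by blast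
    have "f S \<le> f (S \<union> {u})" using S by (intro mono_onD[OF mono]) auto
    then have D: "0 \<le> ?D" using cu by (simp add: marginal_def)
    have "A - f S \<le> ?D * sum c R"
      using gap_le_density_times_cost[OF V mono sub c S(1) R D u] A(2) by simp
    also have "\<dots> \<le> ?D * \<kappa>" using \<kappa>(2) D by (rule mult_left_mono)
    finally have "A - (f S + ?D * c u) \<le> A * exp (- (sum c S + c u) / \<kappa>)"
      using \<kappa>(1) cu D A(1) I by (intro gap_decay_step) simp_all
    moreover have "finite S" using S V finite_subset by blast
    moreover have "f S + ?D * c u = f (insert u S)" using cu by (simp add: marginal_def)
    ultimately show ?thesis using S(2) by (simp add: add.commute)
  qed
  show thesis
    by (rule greedy_run_first_rejection[OF run, where V = V and R = R and I = ?I])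
      (use R zero step that in auto)
qed

text \<open>Since \<open>Q \<subseteq> R\<close>, watching for rejections from \<open>R\<close>
  secures the greedy rate towards both targets at every step.\<close>

lemma greedy_run_two_phase:
  fixes V :: "'a set" and f :: "'a set \<Rightarrow> real"
  defines "\<beta> \<equiv> exp (- 1/2 :: real)"
  assumes V: "finite V" and mono: "mono_on (Pow V) f" and sub: "submodular_on V f"
    and zero: "f {} = 0" and c: "\<And>v. v \<in> V \<Longrightarrow> 0 < c v"
    and run: "greedy_run f c b {} V T" and R: "R \<subseteq> V" "sum c R \<le> b" and b: "0 < b"
    and Q: "Q \<subseteq> R" "\<beta> * f R \<le> f Q" "sum c Q \<le> b/2"
  obtains "R \<subseteq> T"
  | S q where "S \<subseteq> T" "q \<in> R" "b < sum c S + c q" "two_phase b (f R) \<beta> (sum c S) (f S)"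
proof -
  let ?I = "\<lambda>S. two_phase b (f R) \<beta> (sum c S) (f S)"
  have w: "0 \<le> f R" using mono_onD[OF mono, of "{}" R] R zero by simp
  have step: "?I (insert u S)"
    if S: "S \<subseteq> V" "u \<in> V - S" and I: "?I S"
      and u: "\<And>v. v \<in> R - S \<Longrightarrow> marginal f v S / c v \<le> marginal f u S / c u" for S u
  proof -
    let ?D = "marginal f u S / c u"
    have cu: "0 < c u" using c S by blast
    have "f S \<le> f (S \<union> {u})" using S by (intro mono_onD[OF mono]) auto
    then have D: "0 \<le> ?D" using cu by (simp add: marginal_def)
    have "f R - f S \<le> ?D * sum c R"
      by (rule gap_le_density_times_cost[OF V mono sub c S(1) R(1) D u])
    also have "\<dots> \<le> ?D * b" using R(2) D by (rule mult_left_mono)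
    finally have full: "f R - f S \<le> ?D * b" .
    have "\<beta> * f R - f S \<le> ?D * sum c Q"
      using gap_le_density_times_cost[OF V mono sub c S(1) _ D u, of Q] Q R(1) by fastforce
    also have "\<dots> \<le> ?D * (b/2)" using Q(3) D by (rule mult_left_mono)
    finally have "two_phase b (f R) \<beta> (sum c S + c u) (f S + ?D * c u)"
      using b w cu D full I unfolding \<beta>_def by (intro two_phase_step) simp_all
    moreover have "finite S" using S V finite_subset by blast
    moreover have "f S + ?D * c u = f (insert u S)" using cu by (simp add: marginal_def)
    ultimately show ?thesis using S(2) by (simp add: add.commute)
  qed
  have init: "?I {}" using b zero by (simp add: two_phase_def)
  show thesis
    by (rule greedy_run_first_rejection[OF run, where V = V and R = R and I = ?I])
      (use R init step that in auto)
qed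

lemma greedy_or_singleton_bound:
  fixes V :: "'a set" and f :: "'a set \<Rightarrow> real"
  defines "\<beta> \<equiv> exp (- 1/2 :: real)"
  assumes V: "finite V" and mono: "mono_on (Pow V) f" and sub: "submodular_on V f"
    and zero: "f {} = 0" and c: "\<And>v. v \<in> V \<Longrightarrow> 0 < c v"
    and run: "greedy_run f c b {} V T" and R: "R \<subseteq> V" "sum c R \<le> b" and b: "0 < b"
    and single: "\<And>v. v \<in> V \<Longrightarrow> f {v} < (1 - \<beta>) * f R"
  shows "(1 - \<beta>) * f R \<le> f T"
proof -
  have \<beta>: "1/2 < \<beta>" "\<beta> < 1" using exp_neg_half_bounds unfolding \<beta>_def by simp_all
  have w: "0 \<le> f R" using mono_onD[OF mono, of "{}" R] R zero by simp
  have T: "T \<subseteq> V" using greedy_run_subset[OF run] by simp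
  have fT: "f S \<le> f T" if "S \<subseteq> T" for S
    using that T by (intro mono_onD[OF mono]) auto
  have finR: "finite R" using V R finite_subset by blast
  have cR: "0 \<le> c v" if "v \<in> R" for v using c R that by (meson less_imp_le subsetD)
  have "(1 - \<beta>) * f R \<le> 1 * f R" using \<beta> w by (intro mult_right_mono) simp_all
  then have whole: ?thesis if "R \<subseteq> T" using fT[OF that] by simp
  show ?thesis
  proof (cases "\<exists>p\<in>R. b/2 < c p")
    case False
    from V mono sub zero c run R(1) w order.refl b R(2) show ?thesis
    proof (rule greedy_run_gap_decay)
      fix S q
      assume S: "S \<subseteq> T" "q \<in> R" "b < sum c S + c q"
        and gap: "f R - f S \<le> f R * exp (- sum c S / b)"
      have "b/2 \<le> sum c S" using False S(2,3) by force
      then have "exp (- sum c S / b) \<le> \<beta>" using b unfolding \<beta>_def by (simp add: field_simps)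
      then have "f R * exp (- sum c S / b) \<le> f R * \<beta>" using w by (rule mult_left_mono)
      then show ?thesis using gap fT[OF S(1)] by (simp add: algebra_simps)
    qed (use whole in auto)
  next
    case True
    then obtain p where p: "p \<in> R" "b/2 < c p" by blast
    let ?Q = "R - {p}"
    have cQ: "sum c ?Q + c p \<le> b" using R(2) p(1) finR by (simp add: sum.remove)
    \<comment> \<open>Submodularity splits the value of \<open>R\<close> between \<open>p\<close>
      and the rest; as \<open>{p}\<close> is worth less than \<open>(1 - \<beta>) * f R\<close>, the
      rest keeps more than \<open>\<beta> * f R\<close>.\<close>
    have "f (?Q \<union> {p}) + f (?Q \<inter> {p}) \<le> f ?Q + f {p}"
      using R(1) p(1) by (intro sub[unfolded submodular_on_def, rule_format]) auto
    moreover have "?Q \<union> {p} = R" "?Q \<inter> {p} = {}" using p(1) by auto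
    ultimately have "f R \<le> f ?Q + f {p}" using zero by simp
    moreover have "f {p} < (1 - \<beta>) * f R" using single p(1) R(1) by blast
    ultimately have fQ: "\<beta> * f R < f ?Q" by (simp add: algebra_simps)
    have \<beta>w: "(1 - \<beta>) * f R \<le> \<beta> * f R" "0 \<le> \<beta> * f R"
      using \<beta> w by (intro mult_right_mono mult_nonneg_nonneg; simp)+
    have posQ: "0 < sum c ?Q"
    proof (rule sum_pos)
      show "?Q \<noteq> {}" using fQ \<beta>w zero by force
    qed (use finR c R(1) in auto)
    show ?thesis
    \<comment> \<open>The light case tolerates a threshold up to about \<open>0.488 * b\<close>, the
      heavy case needs at least about \<open>0.478 * b\<close>; \<open>29/60\<close> lies in
      between.\<close>
    proof (cases "sum c ?Q \<le> 29/60 * b")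
      case light: True
      \<comment> \<open>With \<open>?Q\<close> as the only target, a rejection of \<open>p\<close>
        does no harm.\<close>
      from V mono sub zero c run _ \<beta>w(2) less_imp_le[OF fQ] posQ order.refl show ?thesis
      proof (rule greedy_run_gap_decay)
        assume "?Q \<subseteq> T"
        then show ?thesis using fT[of ?Q] fQ \<beta>w(1) by linarith
      next
        fix S q
        assume S: "S \<subseteq> T" "q \<in> ?Q" "b < sum c S + c q"
          and gap: "\<beta> * f R - f S \<le> \<beta> * f R * exp (- sum c S / sum c ?Q)"
        have "c q \<le> sum c ?Q" using S(2) finR cR by (intro member_le_sum) auto
        then have "31/29 * sum c ?Q \<le> sum c S" using S(3) light by linarith
        then have "exp (- sum c S / sum c ?Q) \<le> exp (- 31/29)"
          using posQ by (simp add: field_simps)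
        then have "\<beta> * f R * exp (- sum c S / sum c ?Q) \<le> \<beta> * f R * exp (- 31/29)"
          using \<beta>w(2) by (rule mult_left_mono)
        then have "\<beta> * (1 - exp (- 31/29)) * f R \<le> f S" using gap by (simp add: algebra_simps)
        moreover have "(1 - \<beta>) * f R \<le> \<beta> * (1 - exp (- 31/29)) * f R"
          using light_remainder_constant w unfolding \<beta>_def by (rule mult_right_mono)
        ultimately show ?thesis using fT[OF S(1)] by linarith
      qed (use R(1) in auto)
    next
      case heavy: False
      have "sum c ?Q \<le> b/2" using cQ p(2) by linarith
      from V mono sub zero c run R b _ less_imp_le[OF fQ, unfolded \<beta>_def] this show ?thesis
      proof (rule greedy_run_two_phase)
        fix S q
        assume S: "S \<subseteq> T" "q \<in> R" "b < sum c S + c q"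
          and gap: "two_phase b (f R) (exp (- 1/2)) (sum c S) (f S)"
        \<comment> \<open>Whichever element is rejected first, its cost is at most
          \<open>c p \<le> b - sum c ?Q\<close>, which is below \<open>31/60 * b\<close>.\<close>
        have "c q \<le> c p"
        proof (cases "q = p")
          case False
          then have "c q \<le> sum c ?Q" using S(2) finR cR by (intro member_le_sum) auto
          then show ?thesis using cQ p(2) by linarith
        qed simp
        then have x: "29/60 * b < sum c S" using heavy cQ S(3) by linarith
        then have "f R - f S \<le> (1 - \<beta> + \<beta>\<^sup>2) * f R * exp (1/4) * exp (- sum c S / b)"
          using gap b unfolding two_phase_def \<beta>_def by simp
        also have "\<dots> = (1 - \<beta> + \<beta>\<^sup>2) * f R * exp (1/4 - sum c S / b)"
          by (simp add: mult.assoc flip: exp_add)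
        also have "\<dots> \<le> (1 - \<beta> + \<beta>\<^sup>2) * f R * exp (- 7/30)"
        proof (rule mult_left_mono)
          show "exp (1/4 - sum c S / b) \<le> exp (- 7/30)" using x b by (simp add: field_simps)
          show "0 \<le> (1 - \<beta> + \<beta>\<^sup>2) * f R" using \<beta> w by (intro mult_nonneg_nonneg) simp_all
        qed
        also have "\<dots> = (1 - \<beta> + \<beta>\<^sup>2) * exp (- 7/30) * f R" by simp
        also have "\<dots> \<le> \<beta> * f R"
          using heavy_remainder_constant w unfolding \<beta>_def by (rule mult_right_mono)
        finally show ?thesis using fT[OF S(1)] by (simp add: algebra_simps)
      qed (use whole in auto)
    qed
  qed
qed

theorem theorem6p1:
  fixes V :: "'a set" and f :: "'a set \<Rightarrow> real" and c :: "'a \<Rightarrow> real" and b :: real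
  assumes "finite V"
    and "mono_on (Pow V) f"
    and "submodular_on V f"
    and "f {} = 0"
    and "\<And>v. v \<in> V \<Longrightarrow> 0 < c v"
    and "\<And>v. v \<in> V \<Longrightarrow> c v \<le> b"
    and "is_arg_max f (feasible V c b) OPT"
    and "mgreedy V f c b Sm"
  shows "f Sm \<ge> (1 - 1 / sqrt (exp 1)) * f OPT"
proof -
  have "sqrt (exp 1 :: real) = exp (1/2)"
    by (rule real_sqrt_unique) (simp_all flip: exp_of_nat_mult)
  then have factor: "1 / sqrt (exp 1 :: real) = exp (- 1/2)"
    by (simp add: exp_minus inverse_eq_divide)
  have OPT: "OPT \<subseteq> V" "sum c OPT \<le> b"
    using assms(7) by (auto simp: is_arg_max_def feasible_def)
  obtain T where run: "greedy_run f c b {} V T"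
    and out: "if V = {} then Sm = T
      else \<exists>v. is_arg_max (\<lambda>v. f {v}) (\<lambda>v. v \<in> V) v \<and> is_arg_max f (\<lambda>S. S \<in> {{v}, T}) Sm"
    using assms(8) unfolding mgreedy_def by blast
  show ?thesis
  proof (cases "V = {}")
    case True
    then have "OPT = {}" "Sm = {}" using OPT out greedy_run_subset[OF run] by auto
    then show ?thesis using assms(4) by simp
  next
    case False
    then have b: "0 < b" using assms(5,6) by (meson all_not_in_conv less_le_trans)
    have T: "f T \<le> f Sm" and single: "f {v} \<le> f Sm" if "v \<in> V" for v
      using out False that by (auto simp: is_arg_max_linorder intro: order_trans)
    show ?thesis
    \<comment> \<open>Refuting the bound makes every singleton too weak, which is the hypothesis
      that forces the greedy solution to be good.\<close>
    proof (rule ccontr)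
      assume "\<not> ?thesis"
      then have less: "f Sm < (1 - exp (- 1/2)) * f OPT" unfolding factor by simp
      then have "f {v} < (1 - exp (- 1/2)) * f OPT" if "v \<in> V" for v
        using single[OF that] by linarith
      then have "(1 - exp (- 1/2)) * f OPT \<le> f T"
        using assms(1-5) run OPT b by (intro greedy_or_singleton_bound) auto
      then show False using less T False by fastforce
    qed
  qed
qed

end
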